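(* Let $r\ge2$ be an integer, let $\ell$ be an odd prime with $r\mid\ell-1$, let $a,N\in\mathbb F_\ell^*$, let $G=(\mathbb F_\ell^* )^r$, and define $$H_{a,r}(N;\ell)=\{ax+Nx^{-1}:x\in G\}\subseteq\mathbb F_\ell.$$ Put $M=N/a\in\mathbb F_\ell^*$ and $h=|G|=(\ell-1)/r$. If $M\notin G$, then $$|H_{a,r}(N;\ell)|=h.$$ If $M\in G$, then $$|H_{a,r}(N;\ell)|=\frac{h+f(M)}{2},\qquad f(M)=\#\{x\in G:x^2=M\}.$$ In particular, $$\frac{\ell-1}{2r}\le|H_{a,r}(N;\ell)|\le\frac{\ell-1}{r}.$$ More explicitly, if $h$ is odd then $f(M)=1$ for every $M\in G$, while if $h$ is even then $f(M)=2$ when $M\in G^2$ and $f(M)=0$ when $M\in G\setminus G^2$.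
   Context: $(\mathbb F_\ell^* )^r=\{t^r:t\in\mathbb F_\ell^*\}$ is the subgroup of $r$-th powers of $\mathbb F_\ell^*$, and $G^2=\{g^2:g\in G\}$. *)

theory Defs
  imports Complex_Main "HOL-Number_Theory.Residues"
begin

abbreviation prime_field :: "nat \<Rightarrow> int ring"
  where "prime_field l \<equiv> residue_ring (int l)"

definition power_group :: "nat \<Rightarrow> nat \<Rightarrow> int set"
  where "power_group l r =
    {t [^]\<^bsub>prime_field l\<^esub> r | t. t \<in> Units (prime_field l)}"

definition square_set :: "nat \<Rightarrow> int set \<Rightarrow> int set"
  where "square_set l G = {g [^]\<^bsub>prime_field l\<^esub> (2::nat) | g. g \<in> G}"

(* Argument order follows H_{a,r}(N;l). *)
definition H_set :: "int \<Rightarrow> nat \<Rightarrow> int \<Rightarrow> nat \<Rightarrow> int set"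
  where "H_set a r N l =
    {a \<otimes>\<^bsub>prime_field l\<^esub> x \<oplus>\<^bsub>prime_field l\<^esub> N \<otimes>\<^bsub>prime_field l\<^esub> (inv\<^bsub>prime_field l\<^esub> x)
      | x. x \<in> power_group l r}"

definition sqrt_count :: "nat \<Rightarrow> int set \<Rightarrow> int \<Rightarrow> nat"
  where "sqrt_count l G M = card {x \<in> G. x [^]\<^bsub>prime_field l\<^esub> (2::nat) = M}"

end

theory Submission
  imports Defs
begin

text \<open>
  Everything rests on one fact about the map \<open>\<phi> x = a x + N / x\<close> on units: since
  \<open>(\<phi> x - \<phi> y) x y = (x - y) (a x y - N)\<close>, two units have the same image exactly if they are
  equal or their product is \<open>M = N / a\<close>. If \<open>M\<close> lies outside the group \<open>G\<close>, the second case
  never occurs inside \<open>G\<close>, so \<open>\<phi>\<close> is injective there. If \<open>M\<close> lies in \<open>G\<close>, the fibres of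
  \<open>\<phi>\<close> on \<open>G\<close> are the orbits of the involution \<open>x \<mapsto> M / x\<close>, whose fixed points are the
  square roots of \<open>M\<close>, and counting orbits gives \<open>2 |\<phi>(G)| = |G| + f(M)\<close>.

  The values of \<open>f\<close> come out of the same formula. It says that \<open>f(M)\<close> and \<open>|G|\<close> have the
  same parity for every \<open>M\<close> in \<open>G\<close> (take \<open>a = 1\<close> and \<open>N = M\<close>), while \<open>f(M) \<le> 2\<close> because a
  quadratic has at most two roots in a field. Hence \<open>f(M) = 1\<close> if \<open>|G|\<close> is odd; if \<open>|G|\<close> is
  even, \<open>f(M)\<close> is \<open>0\<close> or \<open>2\<close> according to whether \<open>M\<close> has a square root in \<open>G\<close>. The order
  \<open>(l - 1) / r\<close> of \<open>G\<close> is that of the \<open>r\<close>-th power of a primitive root.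
\<close>

section \<open>Images whose fibres are the orbits of an involution\<close>

text \<open>
  A fibre \<open>{x, s x}\<close> has two elements and no fixed point of \<open>s\<close>, or one element that is
  fixed; in either case its elements and its fixed points number two together.
\<close>

lemma card_image_orbits_of_involution:
  assumes fin: "finite A"
    and closed: "\<And>x. x \<in> A \<Longrightarrow> s x \<in> A"
    and fibre: "\<And>x y. \<lbrakk>x \<in> A; y \<in> A\<rbrakk> \<Longrightarrow> \<phi> x = \<phi> y \<longleftrightarrow> y = x \<or> y = s x"
    and invol: "\<And>x. x \<in> A \<Longrightarrow> s (s x) = x"
  shows "2 * card (\<phi> ` A) = card A + card {x \<in> A. s x = x}"
proof -
  define w where "w x = (if s x = x then 2 else 1::nat)" for x
  have "(\<Sum>x\<in>A. w x) = (\<Sum>v\<in>\<phi> ` A. \<Sum>x | x \<in> A \<and> \<phi> x = v. w x)"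
    by (rule sum.image_gen[OF fin])
  also have "\<dots> = (\<Sum>v\<in>\<phi> ` A. 2)"
  proof (rule sum.cong[OF refl])
    fix v assume "v \<in> \<phi> ` A"
    then obtain x where x: "x \<in> A" and v: "v = \<phi> x" by blast
    have "{y \<in> A. \<phi> y = v} = {x, s x}"
      using x closed[OF x] fibre[OF x] unfolding v by (auto simp: eq_commute[of _ "\<phi> x"])
    then show "(\<Sum>y | y \<in> A \<and> \<phi> y = v. w y) = 2"
      using invol[OF x] by (cases "s x = x") (auto simp: w_def)
  qed
  finally have "(\<Sum>x\<in>A. w x) = 2 * card (\<phi> ` A)" by simp
  moreover have "(\<Sum>x\<in>A. w x) = (\<Sum>x\<in>A. 1 + (if s x = x then 1 else 0))"
    by (rule sum.cong) (auto simp: w_def)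
  moreover have "\<dots> = card A + card {x \<in> A. s x = x}"
    using fin unfolding sum.distrib by (simp add: sum.If_cases Int_def)
  ultimately show ?thesis by simp
qed

section \<open>Power subgroups and square roots\<close>

lemma (in comm_group) subgroup_nat_powers:
  "subgroup {t [^] (r::nat) | t. t \<in> carrier G} G"
proof (rule subgroupI)
  show "{t [^] r | t. t \<in> carrier G} \<noteq> {}" by blast
next
  fix x assume "x \<in> {t [^] r | t. t \<in> carrier G}"
  then obtain t where "t \<in> carrier G" "x = t [^] r" by blast
  then have "inv x = inv t [^] r" "inv t \<in> carrier G" by (simp_all add: nat_pow_inv)
  then show "inv x \<in> {t [^] r | t. t \<in> carrier G}" by blast
next
  fix x y assume "x \<in> {t [^] r | t. t \<in> carrier G}" "y \<in> {t [^] r | t. t \<in> carrier G}"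
  then obtain t u where "t \<in> carrier G" "x = t [^] r" "u \<in> carrier G" "y = u [^] r" by blast
  then have "x \<otimes> y = (t \<otimes> u) [^] r" "t \<otimes> u \<in> carrier G" by (simp_all add: nat_pow_distrib)
  then show "x \<otimes> y \<in> {t [^] r | t. t \<in> carrier G}" by blast
qed auto

text \<open>
  If \<open>g\<close> generates the group, \<open>g [^] r\<close> generates the \<open>r\<close>-th powers, and its order is that
  of \<open>g\<close> divided by \<open>r\<close>.
\<close>

lemma (in group) card_nat_powers_cyclic:
  assumes fin: "finite (carrier G)" and g: "g \<in> carrier G"
    and gen: "carrier G = range (\<lambda>i::nat. g [^] i)"
    and r: "r dvd order G"
  shows "card {t [^] r | t. t \<in> carrier G} = order G div r"
proof -
  have pos: "order G > 0" using fin by (simp add: order_gt_0_iff_finite)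
  then have "r \<noteq> 0" using r by (auto intro: Nat.gr0I)
  have range_generate: "range (\<lambda>i::nat. x [^] i) = generate G {x}" if "x \<in> carrier G" for x
    using generate_pow_nat[OF that] ord_ge_1[OF fin that] by auto
  have "order G = ord g"
    using generate_pow_card[OF g] range_generate[OF g] gen by (simp add: order_def)
  have "{t [^] r | t. t \<in> carrier G} = (\<lambda>t. t [^] r) ` range (\<lambda>i::nat. g [^] i)"
    by (simp add: gen Setcompr_eq_image)
  also have "\<dots> = range (\<lambda>i::nat. (g [^] r) [^] i)"
    unfolding image_image using g by (simp add: nat_pow_pow mult.commute)
  finally have "card {t [^] r | t. t \<in> carrier G} = ord (g [^] r)"
    using g by (simp add: range_generate generate_pow_card)
  also have "\<dots> = order G div r"
    using ord_pow[OF g] r \<open>r \<noteq> 0\<close> \<open>order G = ord g\<close> by simp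
  finally show ?thesis .
qed

lemma (in field) card_nat_powers_Units:
  assumes fin: "finite (carrier R)" and r: "r dvd order R - 1"
  shows "card {t [^] r | t. t \<in> Units R} = (order R - 1) div r"
proof -
  interpret U: group "mult_of R" by (rule field_mult_group)
  obtain g where "g \<in> carrier (mult_of R)"
    and "carrier (mult_of R) = {g [^] i | i::nat. i \<in> UNIV}"
    using finite_field_mult_group_has_gen[OF fin] by blast
  then have "card {t [^]\<^bsub>mult_of R\<^esub> r | t. t \<in> carrier (mult_of R)} = order (mult_of R) div r"
    using r finite_mult_of[OF fin]
    by (intro U.card_nat_powers_cyclic[of g])
       (simp_all only: order_mult_of[OF fin] nat_pow_mult_of full_SetCompr_eq UNIV_I simp_thms)
  then show ?thesis
    by (simp only: order_mult_of[OF fin] nat_pow_mult_of carrier_mult_of field_Units)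
qed

text \<open>
  The right side of \<open>(x - y) (x + y) = x\<^sup>2 - y\<^sup>2\<close> vanishes for two square roots \<open>x\<close>, \<open>y\<close> of
  the same element, so any one of them determines the other up to sign.
\<close>

lemma (in domain) card_square_roots_le_2:
  assumes G: "G \<subseteq> carrier R"
  shows "card {x \<in> G. x [^] (2::nat) = M} \<le> 2"
proof (cases "\<exists>y\<in>G. y [^] (2::nat) = M")
  case True
  then obtain y where y: "y \<in> carrier R" "y [^] (2::nat) = M" using G by blast
  have "{x \<in> G. x [^] (2::nat) = M} \<subseteq> {y, \<ominus> y}"
  proof
    fix x assume "x \<in> {x \<in> G. x [^] (2::nat) = M}"
    then have x: "x \<in> carrier R" and M: "x [^] (2::nat) = M" using G by auto
    have "(x \<ominus> y) \<otimes> (x \<oplus> y) = x \<otimes> x \<ominus> y \<otimes> y" using x y(1) by algebra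
    also have "x \<otimes> x = y \<otimes> y" using M y x by (simp add: numeral_2_eq_2)
    finally have "(x \<ominus> y) \<otimes> (x \<oplus> y) = \<zero>" using y(1) by simp
    then have "x \<ominus> y = \<zero> \<or> x \<oplus> y = \<zero>" using x y by (simp add: integral_iff)
    then show "x \<in> {y, \<ominus> y}" using x y(1) by (auto dest: minus_equality[symmetric])
  qed
  then have "card {x \<in> G. x [^] (2::nat) = M} \<le> card {y, \<ominus> y}" by (intro card_mono) auto
  also have "\<dots> \<le> 2" by (simp add: card_insert_if)
  finally show ?thesis .
next
  case False
  then have "{x \<in> G. x [^] (2::nat) = M} = {}" by blast
  then show ?thesis by (simp only: card.empty)
qed

section \<open>The map \<open>x \<mapsto> a x + N / x\<close> on a group of units\<close>

text \<open>
  Clearing denominators in the difference of the two values gives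
  \<open>(x - y) (a x y - N)\<close>, and the cleared factor \<open>x y\<close> is nonzero.
\<close>

lemma (in field) linear_plus_inverse_eq_iff:
  assumes a: "a \<in> Units R" and N: "N \<in> carrier R"
    and x: "x \<in> Units R" and y: "y \<in> Units R"
  shows "a \<otimes> x \<oplus> N \<otimes> inv x = a \<otimes> y \<oplus> N \<otimes> inv y \<longleftrightarrow> y = x \<or> x \<otimes> y = N \<otimes> inv a"
proof -
  have carr [simp]: "a \<in> carrier R" "N \<in> carrier R" "x \<in> carrier R" "y \<in> carrier R"
    "inv x \<in> carrier R" "inv y \<in> carrier R" "inv a \<in> carrier R"
    using assms by auto
  let ?d = "(a \<otimes> x \<oplus> N \<otimes> inv x) \<ominus> (a \<otimes> y \<oplus> N \<otimes> inv y)"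
  have xy: "x \<otimes> y \<noteq> \<zero>" using x y by (simp add: field_Units integral_iff)
  have "?d \<otimes> (x \<otimes> y) = (a \<otimes> (x \<otimes> y) \<otimes> x \<oplus> N \<otimes> y \<otimes> (x \<otimes> inv x))
      \<ominus> (a \<otimes> (x \<otimes> y) \<otimes> y \<oplus> N \<otimes> x \<otimes> (y \<otimes> inv y))"
    using carr by algebra
  also have "\<dots> = (a \<otimes> (x \<otimes> y) \<otimes> x \<oplus> N \<otimes> y) \<ominus> (a \<otimes> (x \<otimes> y) \<otimes> y \<oplus> N \<otimes> x)"
    using x y by simp
  also have "\<dots> = (x \<ominus> y) \<otimes> (a \<otimes> (x \<otimes> y) \<ominus> N)"
    using carr by algebra
  finally have factor: "?d \<otimes> (x \<otimes> y) = (x \<ominus> y) \<otimes> (a \<otimes> (x \<otimes> y) \<ominus> N)" .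
  have "a \<otimes> x \<oplus> N \<otimes> inv x = a \<otimes> y \<oplus> N \<otimes> inv y \<longleftrightarrow> ?d = \<zero>" by simp
  also have "\<dots> \<longleftrightarrow> ?d \<otimes> (x \<otimes> y) = \<zero>" using xy by (simp add: integral_iff)
  also have "\<dots> \<longleftrightarrow> x = y \<or> a \<otimes> (x \<otimes> y) = N"
    unfolding factor by (simp add: integral_iff)
  also have "a \<otimes> (x \<otimes> y) = N \<longleftrightarrow> x \<otimes> y = N \<otimes> inv a"
  proof
    assume "a \<otimes> (x \<otimes> y) = N"
    then have "N \<otimes> inv a = (x \<otimes> y) \<otimes> (a \<otimes> inv a)"
      by (auto simp: m_ac simp del: Units_r_inv)
    then show "x \<otimes> y = N \<otimes> inv a" using a by simp
  next
    assume "x \<otimes> y = N \<otimes> inv a"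
    then have "a \<otimes> (x \<otimes> y) = N \<otimes> (a \<otimes> inv a)" by (simp add: m_ac del: Units_r_inv)
    then show "a \<otimes> (x \<otimes> y) = N" using a by simp
  qed
  finally show ?thesis by blast
qed

lemma (in field) inj_on_linear_plus_inverse:
  assumes G: "subgroup G (units_of R)" and a: "a \<in> Units R" and N: "N \<in> carrier R"
    and M: "N \<otimes> inv a \<notin> G"
  shows "inj_on (\<lambda>x. a \<otimes> x \<oplus> N \<otimes> inv x) G"
proof (rule inj_onI)
  fix x y assume x: "x \<in> G" and y: "y \<in> G"
    and eq: "a \<otimes> x \<oplus> N \<otimes> inv x = a \<otimes> y \<oplus> N \<otimes> inv y"
  have "x \<in> Units R" "y \<in> Units R"
    using x y subgroup.subset[OF G] by (auto simp: units_of_carrier)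
  moreover have "x \<otimes> y \<in> G"
    using subgroup.m_closed[OF G x y] by (simp add: units_of_mult)
  ultimately show "x = y" using linear_plus_inverse_eq_iff[OF a N] eq M by metis
qed

text \<open>
  Inside \<open>G\<close> the equation \<open>x y = M\<close> is solved by \<open>y = M / x\<close>, which stays in \<open>G\<close> because
  \<open>M\<close> does; so the fibres are the orbits of the involution \<open>x \<mapsto> M / x\<close>.
\<close>

lemma (in field) card_image_linear_plus_inverse:
  assumes fin: "finite G" and G: "subgroup G (units_of R)"
    and a: "a \<in> Units R" and N: "N \<in> carrier R" and M: "N \<otimes> inv a \<in> G"
  shows "2 * card ((\<lambda>x. a \<otimes> x \<oplus> N \<otimes> inv x) ` G)
       = card G + card {x \<in> G. x [^] (2::nat) = N \<otimes> inv a}"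
proof -
  define M where "M = N \<otimes> inv a"
  have U: "x \<in> Units R" if "x \<in> G" for x
    using that subgroup.subset[OF G] by (auto simp: units_of_carrier)
  have MG: "M \<in> G" using assms(5) by (simp add: M_def)
  have closed: "M \<otimes> inv x \<in> G" if "x \<in> G" for x
    using subgroup.m_closed[OF G MG subgroup.m_inv_closed[OF G that]] U[OF that]
    by (simp add: units_of_mult units_of_inv)
  have solve: "x \<otimes> y = M \<longleftrightarrow> y = M \<otimes> inv x" if x: "x \<in> G" and y: "y \<in> G" for x y
  proof
    assume "x \<otimes> y = M"
    then have "M \<otimes> inv x = y \<otimes> (x \<otimes> inv x)"
      using U[OF x] U[OF y] by (auto simp: m_ac Units_closed simp del: Units_r_inv)
    then show "y = M \<otimes> inv x" using U[OF x] U[OF y] by (simp add: Units_closed)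
  next
    assume "y = M \<otimes> inv x"
    then have "x \<otimes> y = M \<otimes> (x \<otimes> inv x)"
      using U[OF x] U[OF MG] by (simp add: m_ac Units_closed del: Units_r_inv)
    then show "x \<otimes> y = M" using U[OF x] U[OF MG] by (simp add: Units_closed)
  qed
  have "2 * card ((\<lambda>x. a \<otimes> x \<oplus> N \<otimes> inv x) ` G) = card G + card {x \<in> G. M \<otimes> inv x = x}"
  proof (rule card_image_orbits_of_involution[OF fin closed])
    fix x y assume x: "x \<in> G" and y: "y \<in> G"
    show "a \<otimes> x \<oplus> N \<otimes> inv x = a \<otimes> y \<oplus> N \<otimes> inv y \<longleftrightarrow> y = x \<or> y = M \<otimes> inv x"
      using linear_plus_inverse_eq_iff[OF a N U[OF x] U[OF y]] solve[OF x y]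
      by (simp add: M_def)
  next
    fix x assume x: "x \<in> G"
    have "x \<otimes> (M \<otimes> inv x) = M" using solve[OF x closed[OF x]] by blast
    then have "(M \<otimes> inv x) \<otimes> x = M"
      using U[OF x] U[OF closed[OF x]] by (simp add: m_comm[of _ x] Units_closed)
    then show "M \<otimes> inv (M \<otimes> inv x) = x" using solve[OF closed[OF x] x] by simp
  qed
  moreover have "{x \<in> G. M \<otimes> inv x = x} = {x \<in> G. x [^] (2::nat) = M}"
  proof (intro Collect_cong conj_cong refl)
    fix x assume x: "x \<in> G"
    have "x [^] (2::nat) = x \<otimes> x" using U[OF x] by (simp add: numeral_2_eq_2 Units_closed)
    then show "M \<otimes> inv x = x \<longleftrightarrow> x [^] (2::nat) = M" using solve[OF x x] by auto
  qed
  ultimately show ?thesis by (simp add: M_def)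
qed

text \<open>
  Parity and the bound for square roots leave a single possibility in each case: with
  \<open>a = 1\<close> and \<open>N = M\<close>, the preceding count makes \<open>card G + card {x \<in> G. x [^] 2 = M}\<close> even.
\<close>

lemma (in field) card_square_roots_in_subgroup:
  assumes fin: "finite G" and G: "subgroup G (units_of R)" and M: "M \<in> G"
  shows "card {x \<in> G. x [^] (2::nat) = M} =
    (if odd (card G) then 1 else if \<exists>x\<in>G. x [^] (2::nat) = M then 2 else 0)"
proof -
  let ?S = "{x \<in> G. x [^] (2::nat) = M}"
  have sub: "G \<subseteq> carrier R"
    using subgroup.subset[OF G] by (auto simp: units_of_carrier)
  have Mc: "M \<in> carrier R" using M sub by blast
  then have "M \<otimes> inv \<one> = M" by simp
  then have "card G + card ?S = 2 * card ((\<lambda>x. \<one> \<otimes> x \<oplus> M \<otimes> inv x) ` G)"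
    using card_image_linear_plus_inverse[OF fin G Units_one_closed Mc] M by simp
  then have "even (card G + card ?S)" by simp
  moreover have "card ?S \<le> 2" using sub by (rule card_square_roots_le_2)
  then have "card ?S = 0 \<or> card ?S = 1 \<or> card ?S = 2" by linarith
  moreover have "card ?S = 0 \<longleftrightarrow> \<not> (\<exists>x\<in>G. x [^] (2::nat) = M)" using fin by auto
  ultimately show ?thesis by auto
qed

section \<open>The cardinality of \<open>H\<close>\<close>

theorem proposition9p5:
  fixes r l h :: nat and a N M :: int and G H :: "int set" and f :: "int \<Rightarrow> nat"
  assumes "r \<ge> 2"
    and "prime l" and "odd l" and "r dvd l - 1"
    and "a \<in> Units (prime_field l)" and "N \<in> Units (prime_field l)"
    and "G = power_group l r"
    and "H = H_set a r N l"
    and "M = N \<otimes>\<^bsub>prime_field l\<^esub> inv\<^bsub>prime_field l\<^esub> a"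
    and "h = card G"
    and "f = sqrt_count l G"
  shows "H \<subseteq> carrier (prime_field l) \<and> M \<in> Units (prime_field l)
    \<and> real h = (real l - 1) / real r
    \<and> (M \<notin> G \<longrightarrow> card H = h)
    \<and> (M \<in> G \<longrightarrow> real (card H) = (real h + real (f M)) / 2)
    \<and> (real l - 1) / (2 * real r) \<le> real (card H)
    \<and> real (card H) \<le> (real l - 1) / real r
    \<and> (odd h \<longrightarrow> (\<forall>M'\<in>G. f M' = 1))
    \<and> (even h \<longrightarrow> (\<forall>M'\<in>G. M' \<in> square_set l G \<longrightarrow> f M' = 2)
              \<and> (\<forall>M'\<in>G - square_set l G. f M' = 0))"
proof -
  define R where "R = prime_field l"
  interpret residues_prime l R
    using \<open>prime l\<close> by unfold_locales (simp_all add: R_def)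
  interpret U: comm_group "units_of R" by (rule units_comm_group)
  have a: "a \<in> Units R" and N: "N \<in> Units R" and M_def: "M = N \<otimes>\<^bsub>R\<^esub> inv\<^bsub>R\<^esub> a"
    using assms by (simp_all add: R_def)
  have Nc: "N \<in> carrier R" using N by auto
  have G_def: "G = {t [^]\<^bsub>R\<^esub> r | t. t \<in> Units R}"
    using assms by (simp add: power_group_def R_def)
  also have "\<dots> = {t [^]\<^bsub>units_of R\<^esub> r | t. t \<in> carrier (units_of R)}"
    by (intro Collect_cong ex_cong1) (auto simp: units_of_carrier units_of_pow)
  finally have G: "subgroup G (units_of R)" using U.subgroup_nat_powers by simp
  have GU: "G \<subseteq> Units R" using subgroup.subset[OF G] by (simp add: units_of_carrier)
  have fin: "finite G" using GU finite_Units by (rule finite_subset)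
  have H_def: "H = (\<lambda>x. a \<otimes>\<^bsub>R\<^esub> x \<oplus>\<^bsub>R\<^esub> N \<otimes>\<^bsub>R\<^esub> inv\<^bsub>R\<^esub> x) ` G"
    using assms by (auto simp: H_set_def R_def)
  have f: "f M' = card {x \<in> G. x [^]\<^bsub>R\<^esub> (2::nat) = M'}" for M'
    using assms by (simp add: sqrt_count_def R_def)
  have square: "M' \<in> square_set l G \<longleftrightarrow> (\<exists>x\<in>G. x [^]\<^bsub>R\<^esub> (2::nat) = M')" for M'
    by (auto simp: square_set_def R_def)

  have "order R = l" by (simp add: order_def res_carrier_eq)
  then have "h = (l - 1) div r"
    using card_nat_powers_Units[of r] \<open>r dvd l - 1\<close> \<open>h = card G\<close> by (simp add: G_def)
  moreover have "l \<ge> 1" using \<open>prime l\<close> prime_ge_1_nat by blast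
  ultimately have h: "real h = (real l - 1) / real r"
    using \<open>r dvd l - 1\<close> by (simp add: real_of_nat_div of_nat_diff)

  have outside: "card H = h" if "M \<notin> G"
    using inj_on_linear_plus_inverse[OF G a Nc] that
    by (simp add: H_def M_def \<open>h = card G\<close> card_image)
  have inside: "2 * card H = h + f M" if "M \<in> G"
    using card_image_linear_plus_inverse[OF fin G a Nc] that
    by (simp add: H_def M_def \<open>h = card G\<close> f)
  have upper: "card H \<le> h" unfolding H_def \<open>h = card G\<close> using fin by (rule card_image_le)
  have lower: "h \<le> 2 * card H" using inside outside by (cases "M \<in> G") simp_all
  have f_val: "f M' = (if odd h then 1 else if M' \<in> square_set l G then 2 else 0)"
    if "M' \<in> G" for M'
    using card_square_roots_in_subgroup[OF fin G that] by (simp add: f square \<open>h = card G\<close>)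

  have "H \<subseteq> carrier R" using a N GU by (auto simp: H_def)
  moreover have "M \<in> Units R" using a N by (simp add: M_def)
  moreover have "real (card H) = (real h + real (f M)) / 2" if "M \<in> G"
    using inside[OF that] by (simp flip: of_nat_add)
  moreover have "(real l - 1) / (2 * real r) = real h / 2" using h by simp
  moreover have "real h / 2 \<le> real (card H)" using lower by simp
  moreover have "real (card H) \<le> real h" using upper by simp
  ultimately show ?thesis using h outside f_val by (auto simp: R_def)
qed

end
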